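(* Let $J\in\mathbb{C}^{n\times n}$ be nonsingular. If $Z\in\operatorname{cent}(\operatorname{cosq}(J))$, then $$Z-J^{-1}Z^TJ=Z-J^{-T}Z^TJ^T\in\operatorname{sol}(J),\qquad Z+J^{-1}Z^TJ=Z+J^{-T}Z^TJ^T\in\operatorname{cosol}(J).$$ Similarly, if $Z\in\operatorname{cent}(\operatorname{cosq}^H(J))$, then $$Z-J^{-1}Z^HJ=Z-J^{-H}Z^HJ^H\in\operatorname{sol}^H(J),\qquad Z+J^{-1}Z^HJ=Z+J^{-H}Z^HJ^H\in\operatorname{cosol}^H(J).$$
   Context: For a matrix $A$, $A^T$ is the transpose and $A^H$ the conjugate transpose; $A^{-T}=(A^T)^{-1}$, $A^{-H}=(A^H)^{-1}$. $\operatorname{cent}(A)$ is the set of all $n\times n$ complex matrices commuting with $A$. $\operatorname{cosq}(J)=J^{-T}J$ and $\operatorname{cosq}^H(J)=J^{-H}J$. For a square complex matrix $J$ define the sets of $n\times n$ complex matrices $\operatorname{sol}(J)=\{X: X^TJ+JX=0\}$, $\operatorname{cosol}(J)=\{X:X^TJ-JX=0\}$, $\operatorname{sol}^H(J)=\{X:X^HJ+JX=0\}$, $\operatorname{cosol}^H(J)=\{X:X^HJ-JX=0\}$. *)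

theory Defs
  imports "HOL-Analysis.Analysis"
begin

definition ctranspose :: "complex^'n^'m \<Rightarrow> complex^'m^'n" where
  "ctranspose A = map_matrix cnj (transpose A)"

definition cent :: "complex^'n^'n \<Rightarrow> (complex^'n^'n) set" where
  "cent A = {X. A ** X = X ** A}"

definition cosq :: "complex^'n^'n \<Rightarrow> complex^'n^'n" where
  "cosq J = matrix_inv (transpose J) ** J"

definition cosqH :: "complex^'n^'n \<Rightarrow> complex^'n^'n" where
  "cosqH J = matrix_inv (ctranspose J) ** J"

definition sol :: "complex^'n^'n \<Rightarrow> (complex^'n^'n) set" where
  "sol J = {X. transpose X ** J + J ** X = 0}"

definition cosol :: "complex^'n^'n \<Rightarrow> (complex^'n^'n) set" where
  "cosol J = {X. transpose X ** J - J ** X = 0}"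

definition solH :: "complex^'n^'n \<Rightarrow> (complex^'n^'n) set" where
  "solH J = {X. ctranspose X ** J + J ** X = 0}"

definition cosolH :: "complex^'n^'n \<Rightarrow> (complex^'n^'n) set" where
  "cosolH J = {X. ctranspose X ** J - J ** X = 0}"

end

theory Submission
  imports Defs
begin

text \<open>
  Transpose and conjugate transpose enter only as additive involutions \<open>A \<mapsto> A*\<close> of the matrix
  ring that reverse products, so both halves are one statement about such an involution.

  That \<open>Z\<close> commutes with the cosquare \<open>J*\<^sup>-\<^sup>1 J\<close> says exactly that conjugation by \<open>J\<close> and by
  \<open>J*\<close> agree on \<open>Z\<close>, that is, \<open>J Z J\<^sup>-\<^sup>1 = J* Z J*\<^sup>-\<^sup>1\<close>. Applying the involution gives
  \<open>J*\<^sup>-\<^sup>1 Z* J* = J\<^sup>-\<^sup>1 Z* J\<close>: the adjoint \<open>W\<close> of \<open>Z\<close> with respect to the form \<open>J\<close> is the same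
  whether the form is read from the left or from the right. One expression for \<open>W\<close> gives
  \<open>J W = Z* J\<close>, the other \<open>W* J = J Z\<close>, so \<open>Z\<close> and \<open>W\<close> are adjoint to each other.
  Hence \<open>Z - W\<close> is skew-adjoint and \<open>Z + W\<close> is self-adjoint, and these are the
  memberships to be shown.
\<close>

lemma matrix_inv:
  fixes A :: "'a::semiring_1^'n^'m"
  assumes "invertible A"
  shows matrix_inv_right: "A ** matrix_inv A = mat 1"
    and matrix_inv_left: "matrix_inv A ** A = mat 1"
  using someI_ex[OF assms[unfolded invertible_def]] unfolding matrix_inv_def by auto

lemma matrix_add_rdistrib:
  fixes A :: "'a::semiring_1^'n^'m"
  shows "(A + B) ** C = A ** C + B ** C"
  by (simp add: matrix_matrix_mult_def vec_eq_iff distrib_right sum.distrib)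

lemma matrix_sub_ldistrib:
  fixes A :: "'a::ring_1^'n^'m"
  shows "A ** (B - C) = A ** B - A ** C"
  by (simp add: eq_diff_eq flip: matrix_add_ldistrib)

lemma matrix_sub_rdistrib:
  fixes A :: "'a::ring_1^'n^'m"
  shows "(A - B) ** C = A ** C - B ** C"
  by (simp add: eq_diff_eq flip: matrix_add_rdistrib)

locale matrix_involution = additive star
  for star :: "'a::ring_1^'n^'n \<Rightarrow> 'a^'n^'n" +
  assumes star_mult: "star (A ** B) = star B ** star A"
    and star_star: "star (star A) = A"
begin

lemma star_one: "star (mat 1) = mat 1"
  by (metis matrix_mul_lid matrix_mul_rid star_mult star_star)

lemma
  assumes "invertible J"
  shows invertible_star: "invertible (star J)"
    and star_matrix_inv: "star (matrix_inv J) = matrix_inv (star J)"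
proof -
  have inv: "star J ** star (matrix_inv J) = mat 1" "star (matrix_inv J) ** star J = mat 1"
    using matrix_inv[OF assms] by (simp_all add: star_one flip: star_mult)
  then show inv_star: "invertible (star J)"
    unfolding invertible_def by blast
  have "star (matrix_inv J) = star (matrix_inv J) ** (star J ** matrix_inv (star J))"
    using matrix_inv(1)[OF inv_star] by simp
  then show "star (matrix_inv J) = matrix_inv (star J)"
    using inv(2) by (simp add: matrix_mul_assoc)
qed

text \<open>
  Cancelling the outer factors of \<open>J*\<^sup>-\<^sup>1 J Z = Z J*\<^sup>-\<^sup>1 J\<close> yields \<open>J Z J\<^sup>-\<^sup>1 = J* Z J*\<^sup>-\<^sup>1\<close>, and the
  claim is the image of this equation under the involution.
\<close>
lemma left_adjoint_eq_right_adjoint: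
  assumes J: "invertible J"
    and comm: "(matrix_inv (star J) ** J) ** Z = Z ** (matrix_inv (star J) ** J)"
  shows "matrix_inv J ** star Z ** J = matrix_inv (star J) ** star Z ** star J"
proof -
  note inv = matrix_inv[OF J] and inv_star = matrix_inv[OF invertible_star[OF J]]
  have "J ** Z ** matrix_inv J
      = star J ** ((matrix_inv (star J) ** J) ** Z) ** matrix_inv J"
    using inv_star(1) by (simp add: matrix_mul_assoc)
  also have "\<dots> = star J ** Z ** matrix_inv (star J) ** (J ** matrix_inv J)"
    by (simp only: comm matrix_mul_assoc)
  also have "\<dots> = star J ** Z ** matrix_inv (star J)"
    by (simp add: inv(1))
  finally have "star (J ** Z ** matrix_inv J) = star (star J ** Z ** matrix_inv (star J))"
    by simp
  then show ?thesis
    using J by (simp add: star_mult star_star star_matrix_inv invertible_star matrix_mul_assoc)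
qed

text \<open>
  The first identity uses \<open>W = J\<^sup>-\<^sup>1 Z* J\<close>, where the left factor cancels against \<open>J\<close>. The second
  needs the commutation hypothesis: in the form \<open>W = J*\<^sup>-\<^sup>1 Z* J*\<close>, the image \<open>W* = J Z J\<^sup>-\<^sup>1\<close>
  cancels against \<open>J\<close> on the right.
\<close>
lemma
  assumes J: "invertible J"
  shows mult_adjoint: "J ** (matrix_inv J ** star Z ** J) = star Z ** J"
    and star_adjoint_mult:
      "(matrix_inv (star J) ** J) ** Z = Z ** (matrix_inv (star J) ** J)
        \<Longrightarrow> star (matrix_inv J ** star Z ** J) ** J = J ** Z"
proof -
  note inv = matrix_inv[OF J]
  show "J ** (matrix_inv J ** star Z ** J) = star Z ** J"
    by (simp add: matrix_mul_assoc inv(1))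
  assume comm: "(matrix_inv (star J) ** J) ** Z = Z ** (matrix_inv (star J) ** J)"
  have "star (matrix_inv J ** star Z ** J) ** J = J ** Z ** (matrix_inv J ** J)"
    unfolding left_adjoint_eq_right_adjoint[OF J comm] using J
    by (simp add: star_mult star_star invertible_star matrix_mul_assoc flip: star_matrix_inv)
  then show "star (matrix_inv J ** star Z ** J) ** J = J ** Z"
    by (simp add: inv(2))
qed

lemma
  assumes "invertible J"
    and "(matrix_inv (star J) ** J) ** Z = Z ** (matrix_inv (star J) ** J)"
  defines "W \<equiv> matrix_inv J ** star Z ** J"
  shows diff_adjoint_skew_adjoint: "star (Z - W) ** J + J ** (Z - W) = 0"
    and add_adjoint_self_adjoint: "star (Z + W) ** J - J ** (Z + W) = 0"
proof -
  have JW: "J ** W = star Z ** J" and WJ: "star W ** J = J ** Z"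
    unfolding W_def using assms(1,2) by (simp_all only: mult_adjoint star_adjoint_mult)
  show "star (Z - W) ** J + J ** (Z - W) = 0"
    by (simp add: diff matrix_sub_ldistrib matrix_sub_rdistrib JW WJ)
  show "star (Z + W) ** J - J ** (Z + W) = 0"
    by (simp add: add matrix_add_ldistrib matrix_add_rdistrib JW WJ)
qed

end

interpretation transpose: matrix_involution "transpose :: complex^'n^'n \<Rightarrow> complex^'n^'n"
  by unfold_locales
    (simp_all add: matrix_transpose_mul, simp add: transpose_def vec_eq_iff)

interpretation ctranspose: matrix_involution "ctranspose :: complex^'n^'n \<Rightarrow> complex^'n^'n"
  by unfold_locales
    (simp_all add: ctranspose_def map_matrix_def transpose_def vec_eq_iff matrix_matrix_mult_def
      mult.commute)

theorem theorem2p6: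
  fixes J :: "complex^'n^'n"
  assumes "invertible J"
  shows "(\<forall>Z \<in> cent (cosq J).
            Z - matrix_inv J ** transpose Z ** J
              = Z - matrix_inv (transpose J) ** transpose Z ** transpose J
          \<and> Z - matrix_inv J ** transpose Z ** J \<in> sol J
          \<and> Z + matrix_inv J ** transpose Z ** J
              = Z + matrix_inv (transpose J) ** transpose Z ** transpose J
          \<and> Z + matrix_inv J ** transpose Z ** J \<in> cosol J)
       \<and> (\<forall>Z \<in> cent (cosqH J).
            Z - matrix_inv J ** ctranspose Z ** J
              = Z - matrix_inv (ctranspose J) ** ctranspose Z ** ctranspose J
          \<and> Z - matrix_inv J ** ctranspose Z ** J \<in> solH J
          \<and> Z + matrix_inv J ** ctranspose Z ** J
              = Z + matrix_inv (ctranspose J) ** ctranspose Z ** ctranspose J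
          \<and> Z + matrix_inv J ** ctranspose Z ** J \<in> cosolH J)"
proof (intro conjI ballI)
  fix Z :: "complex^'n^'n"
  assume "Z \<in> cent (cosq J)"
  then have comm: "(matrix_inv (transpose J) ** J) ** Z = Z ** (matrix_inv (transpose J) ** J)"
    by (simp add: cent_def cosq_def)
  note eq = transpose.left_adjoint_eq_right_adjoint[OF assms comm]
  show "Z - matrix_inv J ** transpose Z ** J
      = Z - matrix_inv (transpose J) ** transpose Z ** transpose J"
    and "Z + matrix_inv J ** transpose Z ** J
      = Z + matrix_inv (transpose J) ** transpose Z ** transpose J"
    by (simp_all only: eq)
  show "Z - matrix_inv J ** transpose Z ** J \<in> sol J"
    unfolding sol_def using transpose.diff_adjoint_skew_adjoint[OF assms comm] by blast
  show "Z + matrix_inv J ** transpose Z ** J \<in> cosol J"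
    unfolding cosol_def using transpose.add_adjoint_self_adjoint[OF assms comm] by blast
next
  fix Z :: "complex^'n^'n"
  assume "Z \<in> cent (cosqH J)"
  then have comm: "(matrix_inv (ctranspose J) ** J) ** Z = Z ** (matrix_inv (ctranspose J) ** J)"
    by (simp add: cent_def cosqH_def)
  note eq = ctranspose.left_adjoint_eq_right_adjoint[OF assms comm]
  show "Z - matrix_inv J ** ctranspose Z ** J
      = Z - matrix_inv (ctranspose J) ** ctranspose Z ** ctranspose J"
    and "Z + matrix_inv J ** ctranspose Z ** J
      = Z + matrix_inv (ctranspose J) ** ctranspose Z ** ctranspose J"
    by (simp_all only: eq)
  show "Z - matrix_inv J ** ctranspose Z ** J \<in> solH J"
    unfolding solH_def using ctranspose.diff_adjoint_skew_adjoint[OF assms comm] by blast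
  show "Z + matrix_inv J ** ctranspose Z ** J \<in> cosolH J"
    unfolding cosolH_def using ctranspose.add_adjoint_self_adjoint[OF assms comm] by blast
qed

end
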